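(* There exists a universal constant $c>0$ such that for all integers $q\ge 2$, $n\ge 1$ and $1\le t\le n$ there exists a non-empty orthogonal array $T\subset[q]^n$ of alphabet size $q$, length $n$ and strength $t$ satisfying $|T|\le (qn)^{ct}$.
   Context: For a positive integer $k$, $[k]=\{1,\ldots,k\}$. A subset $T\subset[q]^n$ is an orthogonal array of alphabet size $q$, length $n$ and strength $t$ if for any distinct indices $i_1,\ldots,i_t\in[n]$ and any (not necessarily distinct) values $v_1,\ldots,v_t\in[q]$, $$|\{x\in T: x_{i_1}=v_1,\ldots,x_{i_t}=v_t\}|=q^{-t}|T|.$$ *)

theory Defs
  imports Complex_Main "HOL-Library.FuncSet"
begin

text \<open>Words in \<open>[q]^n\<close> are extensional functions on \<open>{1..n}\<close>, so that distinct
  members of the set are distinct words. In particular the set is finite, so every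
  cardinality below is a genuine one.\<close>

definition words :: "nat \<Rightarrow> nat \<Rightarrow> (nat \<Rightarrow> nat) set" where
  "words q n = {1..n} \<rightarrow>\<^sub>E {1..q}"

definition orthogonal_array :: "nat \<Rightarrow> nat \<Rightarrow> nat \<Rightarrow> (nat \<Rightarrow> nat) set \<Rightarrow> bool" where
  "orthogonal_array q n t T \<longleftrightarrow>
     T \<subseteq> words q n \<and>
     (\<forall>i v. inj_on i {1..t} \<and> i ` {1..t} \<subseteq> {1..n} \<and> v ` {1..t} \<subseteq> {1..q} \<longrightarrow>
        real (card {x \<in> T. \<forall>j\<in>{1..t}. x (i j) = v j}) = real (card T) / real q ^ t)"

end

theory Submission
  imports Defs
begin

text \<open>
For an alphabet whose size is a power of two there are small orthogonal arrays by linear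
algebra over \<open>\<int>/2\<close>: a Gilbert--Varshamov argument gives a large binary code without non-zero
words of small block weight, and its dual is an array of strength \<open>t\<close> with at most
\<open>(n * 2 ^ e) ^ t\<close> elements (\<open>exists_binary_array\<close>). For general \<open>q\<close> there need not be a field with
\<open>q\<close> elements, and the idea is to start from a binary array over a much larger alphabet and to repair
the rounding error exactly.

Let \<open>P\<close> be a power of two slightly above \<open>(n * q) ^ 3\<close>. Reducing a letter modulo \<open>q\<close> is
uniform except for the last \<open>P mod q\<close> letters, which are rare. By a union bound some translate
of the binary array over the alphabet of size \<open>P\<close> has fewer than \<open>2 * t\<close> exceptional letters in
each of its rows (\<open>exists_shift_few_bad\<close>). These letters are replaced by fresh independent
ones, which costs only a factor \<open>q ^ (2 * t)\<close>, and the result has strength exactly \<open>t\<close>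
(\<open>uniform_rows_fill\<close>).

So far rows may be repeated. To separate them, a translate of a second binary array \<open>J\<close>, over an
alphabet of size \<open>p \<le> q\<close>, is added to every row; the translations depend on the row, do not
affect the strength, and can be chosen greedily so that all resulting words are distinct, as
long as \<open>p ^ n\<close> exceeds the number of rows times the square of the size of \<open>J\<close>
(\<open>exists_injective_translates\<close>). This bound is of the form \<open>(n * q) ^ (8 * t)\<close>. If it is at
least \<open>p ^ n\<close>, then, as \<open>q \<le> p\<^sup>2\<close>, the set of all \<open>q ^ n\<close> words has at most
\<open>(n * q) ^ (16 * t)\<close> elements and is itself the array.\<close>

section \<open>Families of words of a given strength\<close>

text \<open>An array whose rows may coincide: the rows are indexed by \<open>R\<close>, the letters are
\<open>0, \<dots>, q - 1\<close>, and only the coordinates in \<open>{1..n}\<close> matter. The strength condition is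
stated per set of coordinates and cleared of denominators. Indexing makes multiplicities
explicit, which is what the intermediate arrays of the construction need.\<close>

definition uniform_rows ::
    "nat \<Rightarrow> nat \<Rightarrow> nat \<Rightarrow> 'r set \<Rightarrow> ('r \<Rightarrow> nat \<Rightarrow> nat) \<Rightarrow> bool" where
  "uniform_rows q n t R X \<longleftrightarrow> finite R \<and> (\<forall>r\<in>R. \<forall>i\<in>{1..n}. X r i < q) \<and>
     (\<forall>I v. I \<subseteq> {1..n} \<longrightarrow> card I = t \<longrightarrow> (\<forall>i\<in>I. v i < q) \<longrightarrow>
        real (card {r \<in> R. \<forall>i\<in>I. X r i = v i}) * real q ^ t = real (card R))"

lemma inj_on_restrict_rows_iff:
  "inj_on (\<lambda>r. restrict (X r) A) R \<longleftrightarrow>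
     (\<forall>a\<in>R. \<forall>b\<in>R. (\<forall>i\<in>A. X a i = X b i) \<longrightarrow> a = b)"
proof -
  have "restrict (X a) A = restrict (X b) A \<longleftrightarrow> (\<forall>i\<in>A. X a i = X b i)" for a b
    by (metis restrict_apply' restrict_ext)
  then show ?thesis by (simp add: inj_on_def)
qed

lemma sum_prod_of_bool:
  assumes "finite R" "finite I"
  shows "(\<Sum>r\<in>R. \<Prod>i\<in>I. of_bool (P r i)) = real (card {r \<in> R. \<forall>i\<in>I. P r i})"
proof -
  have "(\<Prod>i\<in>I. of_bool (P r i)) = (of_bool (\<forall>i\<in>I. P r i) :: real)" for r
    using assms(2) by (induction rule: finite_induct) auto
  then show ?thesis
    using assms(1) by (simp add: Int_def)
qed

text \<open>Seen on \<open>t\<close> coordinates, the rows are independent uniform letters, so the expectation of a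
product of one-letter functions is the product of the expectations. Every later strength
computation is an instance: the required event is written as a product of test functions and
only a sum over a single alphabet has to be evaluated.\<close>

lemma uniform_rows_test:
  fixes h :: "nat \<Rightarrow> nat \<Rightarrow> real"
  assumes U: "uniform_rows q n t R X" and I: "I \<subseteq> {1..n}" "card I = t"
  shows "(\<Sum>r\<in>R. \<Prod>i\<in>I. h i (X r i)) * real q ^ t = real (card R) * (\<Prod>i\<in>I. \<Sum>a<q. h i a)"
proof -
  have fI: "finite I" using I(1) finite_subset by blast
  have fR: "finite R" using U by (simp add: uniform_rows_def)
  define W where "W = I \<rightarrow>\<^sub>E {..<q}"
  have fW: "finite W" unfolding W_def by (rule finite_PiE) (use fI in auto)
  have img: "(\<lambda>r. restrict (X r) I) ` R \<subseteq> W"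
    using U I(1) unfolding uniform_rows_def W_def by fastforce
  have eq: "{r \<in> R. restrict (X r) I = f} = {r \<in> R. \<forall>i\<in>I. X r i = f i}" if "f \<in> W" for f
  proof -
    have "restrict (X r) I = f \<longleftrightarrow> (\<forall>i\<in>I. X r i = f i)" for r
      using that unfolding W_def by (auto simp: fun_eq_iff PiE_def extensional_def restrict_def)
    then show ?thesis by blast
  qed
  have "(\<Sum>r\<in>R. \<Prod>i\<in>I. h i (X r i)) * real q ^ t
      = (\<Sum>f\<in>W. \<Sum>r\<in>{r \<in> R. restrict (X r) I = f}. \<Prod>i\<in>I. h i (X r i)) * real q ^ t"
    using sum.group[OF fR fW img, of "\<lambda>r. \<Prod>i\<in>I. h i (X r i)"] by simp
  also have "\<dots> = (\<Sum>f\<in>W. \<Sum>r\<in>{r \<in> R. \<forall>i\<in>I. X r i = f i}. \<Prod>i\<in>I. h i (f i)) * real q ^ t"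
    by (intro arg_cong2[where f = "(*)"] sum.cong refl prod.cong) (auto simp: eq)
  also have "\<dots> = (\<Sum>f\<in>W. (real (card {r \<in> R. \<forall>i\<in>I. X r i = f i}) * real q ^ t) * (\<Prod>i\<in>I. h i (f i)))"
    by (simp add: sum_distrib_left sum_distrib_right mult_ac)
  also have "\<dots> = (\<Sum>f\<in>W. real (card R) * (\<Prod>i\<in>I. h i (f i)))"
  proof (intro sum.cong refl)
    fix f assume "f \<in> W"
    then have "\<forall>i\<in>I. f i < q" unfolding W_def by auto
    then have "real (card {r \<in> R. \<forall>i\<in>I. X r i = f i}) * real q ^ t = real (card R)"
      using U I unfolding uniform_rows_def by blast
    then show "(real (card {r \<in> R. \<forall>i\<in>I. X r i = f i}) * real q ^ t) * (\<Prod>i\<in>I. h i (f i))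
        = real (card R) * (\<Prod>i\<in>I. h i (f i))" by simp
  qed
  also have "\<dots> = real (card R) * (\<Prod>i\<in>I. \<Sum>a<q. h i a)"
    unfolding W_def by (subst prod_sum_PiE) (use fI in \<open>auto simp: sum_distrib_left\<close>)
  finally show ?thesis .
qed

lemma uniform_rowsI:
  assumes "finite R" "\<And>r i. r \<in> R \<Longrightarrow> i \<in> {1..n} \<Longrightarrow> X r i < q"
    and "\<And>I v. I \<subseteq> {1..n} \<Longrightarrow> card I = t \<Longrightarrow> finite I \<Longrightarrow> \<forall>i\<in>I. v i < q \<Longrightarrow>
      (\<Sum>r\<in>R. \<Prod>i\<in>I. of_bool (X r i = v i)) * real q ^ t = real (card R)"
  shows "uniform_rows q n t R X"
  unfolding uniform_rows_def
proof (intro conjI allI impI)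
  fix I v assume *: "I \<subseteq> {1..n}" "card I = t" "\<forall>i\<in>I. v i < q"
  then have "finite I" using finite_subset by blast
  with * assms(3)[of I v] show "real (card {r \<in> R. \<forall>i\<in>I. X r i = v i}) * real q ^ t = real (card R)"
    by (simp add: sum_prod_of_bool assms(1))
qed (use assms in auto)

lemma mod_add_right_cancel_nat:
  fixes a b s q :: nat
  assumes "(a + s) mod q = (b + s) mod q"
  shows "a mod q = b mod q"
proof -
  have "(int a + int s) mod int q = (int b + int s) mod int q"
    using assms by (metis of_nat_add of_nat_mod)
  then have "int q dvd (int a + int s) - (int b + int s)" by (simp add: mod_eq_dvd_iff)
  then have "int a mod int q = int b mod int q" by (simp add: mod_eq_dvd_iff)
  then show ?thesis by (metis of_nat_eq_iff of_nat_mod)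
qed

lemma bij_betw_add_mod:
  fixes s q :: nat
  assumes "q > 0"
  shows "bij_betw (\<lambda>a. (a + s) mod q) {..<q} {..<q}"
proof -
  have "inj_on (\<lambda>a. (a + s) mod q) {..<q}"
  proof (rule inj_onI)
    fix a b assume "a \<in> {..<q}" "b \<in> {..<q}" and e: "(a + s) mod q = (b + s) mod q"
    moreover from e have "a mod q = b mod q" by (rule mod_add_right_cancel_nat)
    ultimately show "a = b" by simp
  qed
  moreover have "(\<lambda>a. (a + s) mod q) ` {..<q} \<subseteq> {..<q}" using assms by auto
  ultimately show ?thesis
    by (simp add: bij_betw_def endo_inj_surj)
qed

lemma sum_add_mod_of_bool:
  assumes "v < (q::nat)"
  shows "(\<Sum>a<q. of_bool ((a + s) mod q = v)) = (1::real)"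
proof -
  have "(\<Sum>a<q. of_bool ((a + s) mod q = v)) = (\<Sum>a<q. of_bool (a = v) :: real)"
    using sum.reindex_bij_betw[OF bij_betw_add_mod[of q s], of "\<lambda>a. of_bool (a = v) :: real"] assms
    by (simp del: sum_of_bool_eq)
  also have "\<dots> = 1" using assms by (simp add: of_bool_def del: sum_of_bool_eq)
  finally show ?thesis .
qed

text \<open>Adding a fixed word permutes the alphabet in each coordinate, which preserves strength. This
provides the free translations used in both selection arguments below.\<close>

lemma uniform_rows_shift:
  assumes U: "uniform_rows q n t R X" and q: "q > 0"
  shows "uniform_rows q n t R (\<lambda>r i. (X r i + s i) mod q)"
proof (rule uniform_rowsI)
  fix I v assume I: "I \<subseteq> {1..n}" "card I = t" "finite I" "\<forall>i\<in>I. v i < q"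
  show "(\<Sum>r\<in>R. \<Prod>i\<in>I. of_bool ((X r i + s i) mod q = v i)) * real q ^ t = real (card R)"
    using uniform_rows_test[OF U I(1,2), of "\<lambda>i a. of_bool ((a + s i) mod q = v i)"] I(4)
    by (simp add: sum_add_mod_of_bool del: sum_of_bool_eq)
qed (use U q in \<open>auto simp: uniform_rows_def\<close>)

section \<open>Binary arrays from dual subgroups\<close>

text \<open>The character of the group of finite sets under symmetric difference, that is, of a power of
\<open>\<int>/2\<close>; sets are the supports of binary vectors.\<close>

definition parity_sign :: "'a set \<Rightarrow> 'a set \<Rightarrow> real" where
  "parity_sign u x = (-1) ^ card (u \<inter> x)"

lemma parity_sign_commute: "parity_sign u x = parity_sign x u"
  by (simp add: parity_sign_def Int_commute)

lemma parity_sign_sym_diff: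
  assumes "finite u" "finite v"
  shows "parity_sign (sym_diff u v) x = parity_sign u x * parity_sign v x"
proof -
  have 1: "card (u \<inter> x) = card ((u - v) \<inter> x) + card (u \<inter> v \<inter> x)"
    using assms by (subst card_Un_disjoint[symmetric]) (auto intro: arg_cong[where f = card])
  have 2: "card (v \<inter> x) = card ((v - u) \<inter> x) + card (u \<inter> v \<inter> x)"
    using assms by (subst card_Un_disjoint[symmetric]) (auto intro: arg_cong[where f = card])
  have 3: "card (sym_diff u v \<inter> x) = card ((u - v) \<inter> x) + card ((v - u) \<inter> x)"
    using assms by (subst card_Un_disjoint[symmetric]) (auto intro: arg_cong[where f = card])
  show ?thesis
    unfolding parity_sign_def 1 2 3 by (simp add: power_add)
qed

lemma sym_diff_cancel [simp]: "sym_diff (sym_diff u v) v = u"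
  by blast

text \<open>Orthogonality of characters: if some element of \<open>U\<close> has sign \<open>-1\<close> at \<open>x\<close>, translating by
it negates the sum. Hence the sum over \<open>U\<close> detects membership of \<open>x\<close> in the dual of \<open>U\<close>.\<close>

lemma sum_parity_sign_dual:
  assumes G: "finite G" "U \<subseteq> Pow G" and cl: "\<And>u v. u \<in> U \<Longrightarrow> v \<in> U \<Longrightarrow> sym_diff u v \<in> U"
  shows "(\<Sum>u\<in>U. parity_sign u x) = real (card U) * of_bool (\<forall>u\<in>U. even (card (u \<inter> x)))"
proof (cases "\<forall>u\<in>U. even (card (u \<inter> x))")
  case True
  then show ?thesis by (simp add: parity_sign_def)
next
  case False
  then obtain w where w: "w \<in> U" "odd (card (w \<inter> x))" by blast
  have fin: "finite u" if "u \<in> U" for u using that G finite_subset by blast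
  have "(\<Sum>u\<in>U. parity_sign u x) = (\<Sum>u\<in>U. parity_sign (sym_diff u w) x)"
    by (rule sum.reindex_bij_witness[of _ "\<lambda>u. sym_diff u w" "\<lambda>u. sym_diff u w"])
       (use cl w in auto)
  also have "\<dots> = (\<Sum>u\<in>U. - parity_sign u x)"
    using w fin by (intro sum.cong refl) (simp add: parity_sign_sym_diff parity_sign_def[of w])
  also have "\<dots> = - (\<Sum>u\<in>U. parity_sign u x)" by (simp add: sum_negf)
  finally show ?thesis using False by simp
qed

text \<open>Flipping one free bit of \<open>x\<close>, at a position in \<open>u - K\<close>, preserves the cylinder and negates
every term.\<close>

lemma sum_parity_sign_cylinder:
  assumes G: "finite G" "K \<subseteq> G" "u \<subseteq> G" "\<not> u \<subseteq> K"
  shows "(\<Sum>x\<in>{x\<in>Pow G. x \<inter> K = b}. parity_sign u x) = 0"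
proof -
  obtain g where g: "g \<in> u" "g \<notin> K" using G by blast
  let ?S = "{x\<in>Pow G. x \<inter> K = b}"
  have "(\<Sum>x\<in>?S. parity_sign u x) = (\<Sum>x\<in>?S. parity_sign u (sym_diff x {g}))"
    by (rule sum.reindex_bij_witness[of _ "\<lambda>x. sym_diff x {g}" "\<lambda>x. sym_diff x {g}"])
       (use g G in auto)
  also have "\<dots> = (\<Sum>x\<in>?S. - parity_sign u x)"
  proof (intro sum.cong refl)
    fix x assume "x \<in> ?S"
    then have "finite x" using G(1) finite_subset by blast
    then have "parity_sign (sym_diff x {g}) u = - parity_sign x u"
      using g by (subst parity_sign_sym_diff) (auto simp: parity_sign_def)
    then show "parity_sign u (sym_diff x {g}) = - parity_sign u x"
      by (simp only: parity_sign_commute[of u])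
  qed
  also have "\<dots> = - (\<Sum>x\<in>?S. parity_sign u x)" by (simp add: sum_negf)
  finally show ?thesis by simp
qed

lemma card_cylinder:
  assumes "finite G" "K \<subseteq> G" "b \<subseteq> K"
  shows "card {x\<in>Pow G. x \<inter> K = b} = 2 ^ (card G - card K)"
proof -
  have "bij_betw (\<lambda>y. y \<union> b) (Pow (G - K)) {x\<in>Pow G. x \<inter> K = b}"
    by (rule bij_betw_byWitness[where f' = "\<lambda>x. x - K"]) (use assms in auto)
  then have "card {x\<in>Pow G. x \<inter> K = b} = card (Pow (G - K))"
    by (rule bij_betw_same_card[symmetric])
  then show ?thesis using assms finite_subset[OF assms(2,1)]
    by (simp add: card_Pow card_Diff_subset)
qed

text \<open>The dual of \<open>U\<close> restricts uniformly to every set \<open>K\<close> of positions that contains no non-empty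
member of \<open>U\<close>: expanding the indicator of the dual in characters, only the trivial character
survives the summation over a cylinder on \<open>K\<close>. The case \<open>K = {}\<close> gives the size of the
dual.\<close>

lemma card_dual_cylinder:
  assumes G: "finite G" "U \<subseteq> Pow G" "{} \<in> U"
    and cl: "\<And>u v. u \<in> U \<Longrightarrow> v \<in> U \<Longrightarrow> sym_diff u v \<in> U"
    and K: "K \<subseteq> G" "b \<subseteq> K" "\<And>u. u \<in> U \<Longrightarrow> u \<subseteq> K \<Longrightarrow> u = {}"
  shows "card {x\<in>Pow G. (\<forall>u\<in>U. even (card (u \<inter> x))) \<and> x \<inter> K = b} * card U = 2 ^ (card G - card K)"
proof -
  let ?S = "{x\<in>Pow G. x \<inter> K = b}"
  have fS: "finite ?S" using G by simp
  have fU: "finite U" using G finite_subset by blast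
  have "{x\<in>Pow G. (\<forall>u\<in>U. even (card (u \<inter> x))) \<and> x \<inter> K = b} = ?S \<inter> {x. \<forall>u\<in>U. even (card (u \<inter> x))}"
    by blast
  then have "real (card {x\<in>Pow G. (\<forall>u\<in>U. even (card (u \<inter> x))) \<and> x \<inter> K = b} * card U)
      = (\<Sum>x\<in>?S. real (card U) * of_bool (\<forall>u\<in>U. even (card (u \<inter> x))))"
    using fS by (simp flip: sum_distrib_left)
  also have "\<dots> = (\<Sum>x\<in>?S. \<Sum>u\<in>U. parity_sign u x)"
    by (simp only: sum_parity_sign_dual[OF G(1,2) cl])
  also have "\<dots> = (\<Sum>u\<in>U. \<Sum>x\<in>?S. parity_sign u x)" by (rule sum.swap)
  also have "\<dots> = (\<Sum>u\<in>U. if u = {} then real (card ?S) else 0)"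
  proof (intro sum.cong refl)
    fix u assume u: "u \<in> U"
    show "(\<Sum>x\<in>?S. parity_sign u x) = (if u = {} then real (card ?S) else 0)"
    proof (cases "u = {}")
      case True then show ?thesis by (simp add: parity_sign_def)
    next
      case False
      then have "\<not> u \<subseteq> K" using K(3) u by blast
      then show ?thesis using sum_parity_sign_cylinder[of G K u b] G u K False by auto
    qed
  qed
  also have "\<dots> = real (card ?S)" using fU G(3) by simp
  also have "\<dots> = real (2 ^ (card G - card K))" using card_cylinder[OF G(1) K(1,2)] by simp
  finally show ?thesis by (simp only: of_nat_eq_iff)
qed

text \<open>A Gilbert--Varshamov argument. Take a subgroup \<open>U\<close> of largest size meeting \<open>S\<close> only in the
empty set. If some \<open>y\<close> were outside all the translates of \<open>U\<close> by members of \<open>S\<close>, then adding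
the coset of \<open>y\<close> would give a larger such subgroup; so these translates cover the whole group.\<close>

lemma exists_large_avoiding_subgroup:
  assumes G: "finite G" "S \<subseteq> Pow G" "{} \<in> S"
  obtains U where "U \<subseteq> Pow G" "{} \<in> U" "\<And>u v. u \<in> U \<Longrightarrow> v \<in> U \<Longrightarrow> sym_diff u v \<in> U"
    "U \<inter> S = {{}}" "2 ^ card G \<le> card S * card U"
proof -
  define F where "F = {U. U \<subseteq> Pow G \<and> {} \<in> U \<and> (\<forall>u\<in>U. \<forall>v\<in>U. sym_diff u v \<in> U) \<and> U \<inter> S = {{}}}"
  have fF: "finite F" unfolding F_def using G by (auto intro: finite_subset[of _ "Pow (Pow G)"])
  have "{{}} \<in> F" using G unfolding F_def by auto
  then have ne: "F \<noteq> {}" by blast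
  obtain U where U: "U \<in> F" "\<And>U'. U' \<in> F \<Longrightarrow> card U' \<le> card U"
  proof -
    have "Max (card ` F) \<in> card ` F" using fF ne by (intro Max_in) auto
    then obtain U where "U \<in> F" "card U = Max (card ` F)" by auto
    moreover have "card U' \<le> Max (card ` F)" if "U' \<in> F" for U'
      using that fF by (intro Max_ge) auto
    ultimately show thesis using that by metis
  qed
  have UG: "U \<subseteq> Pow G" and U0: "{} \<in> U" and cl: "\<And>u v. u \<in> U \<Longrightarrow> v \<in> U \<Longrightarrow> sym_diff u v \<in> U"
    and US: "U \<inter> S = {{}}" using U(1) unfolding F_def by blast+
  have fU: "finite U" using UG G(1) finite_subset by blast
  have fS: "finite S" using G finite_subset by blast
  have "Pow G \<subseteq> (\<lambda>(s, u). sym_diff s u) ` (S \<times> U)"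
  proof
    fix y assume y: "y \<in> Pow G"
    show "y \<in> (\<lambda>(s, u). sym_diff s u) ` (S \<times> U)"
    proof (rule ccontr)
      assume no: "\<not> ?thesis"
      have no': "sym_diff y u \<notin> S" if "u \<in> U" for u
      proof
        assume "sym_diff y u \<in> S"
        moreover have "y = sym_diff (sym_diff y u) u" by simp
        ultimately show False using no that by (metis (mono_tags, lifting) SigmaI case_prod_conv image_eqI)
      qed
      define U' where "U' = U \<union> (\<lambda>u. sym_diff y u) ` U"
      have yU: "y \<notin> U"
        using no'[of y] G(3) by auto
      have "sym_diff y {} \<in> U'" unfolding U'_def using U0 by blast
      then have yU': "y \<in> U'" by simp
      have "U' \<in> F" unfolding F_def
      proof (intro CollectI conjI ballI)
        show "U' \<subseteq> Pow G" unfolding U'_def using UG y by auto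
        show "{} \<in> U'" unfolding U'_def using U0 by blast
        show "U' \<inter> S = {{}}" unfolding U'_def using US no' by auto
        have A: "sym_diff a (sym_diff y b) = sym_diff y (sym_diff a b)"
          "sym_diff (sym_diff y b) a = sym_diff y (sym_diff a b)"
          "sym_diff (sym_diff y a) (sym_diff y b) = sym_diff a b" for a b by blast+
        fix u v assume "u \<in> U'" "v \<in> U'"
        then show "sym_diff u v \<in> U'" unfolding U'_def using cl A
          by (smt (verit, del_insts) Un_iff image_iff)
      qed
      then have "card U' \<le> card U" using U(2) by blast
      moreover have "card U < card U'"
        by (rule psubset_card_mono) (use fU yU yU' in \<open>auto simp: U'_def\<close>)
      ultimately show False by simp
    qed
  qed
  then have "card (Pow G) \<le> card (S \<times> U)"
    using fS fU by (meson card_image_le card_mono finite_SigmaI finite_imageI order_trans)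
  then have "2 ^ card G \<le> card S * card U" using G(1) by (simp add: card_Pow card_cartesian_product)
  then show thesis using that UG U0 cl US by blast
qed

lemma card_subsets_le_power:
  assumes "k \<le> n"
  shows "card {I. I \<subseteq> {1..n} \<and> card I = k} \<le> n ^ k"
  using n_subsets[of "{1..n}" k] binomial_le_pow[OF assms] by simp

text \<open>Each letter of the alphabet of size \<open>2 ^ e\<close> is a block of \<open>e\<close> bits. The set \<open>S\<close> to be avoided
consists of the bit vectors supported on at most \<open>t\<close> blocks; the dual of a large subgroup
avoiding \<open>S\<close> has at most \<open>card S\<close> elements and is uniform on any \<open>t\<close> blocks.\<close>

lemma exists_binary_array:
  assumes tn: "t \<le> n"
  obtains V :: "(nat \<times> nat) set set" and X where
    "uniform_rows (2 ^ e) n t V X" "V \<noteq> {}" "card V \<le> (n * 2 ^ e) ^ t"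
    "inj_on (\<lambda>x. restrict (X x) {1..n}) V"
proof -
  define G where "G = {1..n} \<times> {..<e}"
  define S where "S = (\<Union>I\<in>{I. I \<subseteq> {1..n} \<and> card I = t}. Pow (I \<times> {..<e}))"
  have fG: "finite G" and cG: "card G = n * e" unfolding G_def by (simp_all add: card_cartesian_product)
  have SG: "S \<subseteq> Pow G" unfolding S_def G_def by auto
  have "{1..t} \<subseteq> {1..n}" "card {1..t} = t" using tn by auto
  then have S0: "{} \<in> S" unfolding S_def by blast
  have "card S \<le> (\<Sum>I\<in>{I. I \<subseteq> {1..n} \<and> card I = t}. card (Pow (I \<times> {..<e})))"
    unfolding S_def by (rule card_UN_le) simp
  also have "\<dots> = (\<Sum>I\<in>{I. I \<subseteq> {1..n} \<and> card I = t}. 2 ^ (t * e))"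
  proof (intro sum.cong refl)
    fix I assume I: "I \<in> {I. I \<subseteq> {1..n} \<and> card I = t}"
    then have "finite I" using finite_subset by blast
    then show "card (Pow (I \<times> {..<e})) = 2 ^ (t * e)"
      using I by (simp add: card_Pow card_cartesian_product)
  qed
  also have "\<dots> \<le> n ^ t * 2 ^ (t * e)" using card_subsets_le_power[OF tn] by simp
  also have "\<dots> = (n * 2 ^ e) ^ t" by (simp add: power_mult_distrib mult.commute flip: power_mult)
  finally have cS: "card S \<le> (n * 2 ^ e) ^ t" .
  obtain U where U: "U \<subseteq> Pow G" "{} \<in> U" and cl: "\<And>u v. u \<in> U \<Longrightarrow> v \<in> U \<Longrightarrow> sym_diff u v \<in> U"
    and US: "U \<inter> S = {{}}" and cU: "2 ^ card G \<le> card S * card U"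
    using exists_large_avoiding_subgroup[OF fG SG S0] by metis
  define V where "V = {x\<in>Pow G. \<forall>u\<in>U. even (card (u \<inter> x))}"
  have fV: "finite V" unfolding V_def using fG by simp
  have cU0: "card U > 0" using U fG by (auto simp: card_gt_0_iff intro: finite_subset)
  have VU: "card V * card U = 2 ^ card G"
    using card_dual_cylinder[OF fG U cl, of "{}" "{}"] unfolding V_def by simp
  have "{} \<in> V" unfolding V_def by simp
  then have V0: "V \<noteq> {}" by blast
  have "card V * card U \<le> card S * card U" using VU cU by simp
  then have cV: "card V \<le> (n * 2 ^ e) ^ t" using cU0 cS by simp
  have "card (Pow {..<e}) = card {..<(2::nat) ^ e}" by (simp add: card_Pow)
  then obtain \<beta> where \<beta>: "bij_betw \<beta> (Pow {..<e}) {..<(2::nat) ^ e}"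
    using finite_same_card_bij[of "Pow {..<e}" "{..<(2::nat) ^ e}"] by auto
  define X where "X = (\<lambda>x i. \<beta> (x `` {i :: nat}))"
  have rowPow: "x `` {i} \<in> Pow {..<e}" if "x \<in> V" for x i
    using that unfolding V_def G_def by auto
  have \<beta>inj: "\<beta> a = \<beta> b \<longleftrightarrow> a = b" if "a \<in> Pow {..<e}" "b \<in> Pow {..<e}" for a b
    using \<beta> that by (meson bij_betw_def inj_on_eq_iff)
  have "uniform_rows (2 ^ e) n t V X"
    unfolding uniform_rows_def
  proof (intro conjI allI impI ballI)
    show "finite V" by (fact fV)
    show "X x i < 2 ^ e" if "x \<in> V" for x i
      unfolding X_def using rowPow[OF that, of i] \<beta> unfolding bij_betw_def by blast
    fix I v assume I: "I \<subseteq> {1..n}" "card I = t" "\<forall>i\<in>I. v i < (2::nat) ^ e"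
    have fI: "finite I" using I(1) finite_subset by blast
    define w where "w = (\<lambda>i. inv_into (Pow {..<e}) \<beta> (v i))"
    have w: "w i \<in> Pow {..<e}" "\<beta> (w i) = v i" if "i \<in> I" for i
      using that I(3) \<beta> unfolding w_def bij_betw_def
      by (metis inv_into_into lessThan_iff, metis f_inv_into_f lessThan_iff)
    define K where "K = I \<times> {..<e}"
    define b where "b = Sigma I w"
    have KG: "K \<subseteq> G" unfolding K_def G_def using I(1) by auto
    have bK: "b \<subseteq> K" unfolding b_def K_def using w by fastforce
    have cK: "card K = t * e" unfolding K_def using I by (simp add: card_cartesian_product)
    have uK: "u = {}" if "u \<in> U" "u \<subseteq> K" for u
    proof -
      have "u \<in> S" unfolding S_def using that I unfolding K_def by blast
      then show ?thesis using US that by blast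
    qed
    have "(\<forall>i\<in>I. X x i = v i) \<longleftrightarrow> x \<inter> K = b" if x: "x \<in> V" for x
    proof -
      have "(\<forall>i\<in>I. X x i = v i) \<longleftrightarrow> (\<forall>i\<in>I. x `` {i} = w i)"
        unfolding X_def using w \<beta>inj rowPow[OF x] by metis
      also have "\<dots> \<longleftrightarrow> x \<inter> K = b"
        using x rowPow[OF x] w unfolding b_def K_def V_def G_def by blast
      finally show ?thesis .
    qed
    then have "{x \<in> V. \<forall>i\<in>I. X x i = v i} = {x\<in>Pow G. (\<forall>u\<in>U. even (card (u \<inter> x))) \<and> x \<inter> K = b}"
      unfolding V_def by blast
    then have "card {x \<in> V. \<forall>i\<in>I. X x i = v i} * card U = 2 ^ (card G - card K)"
      using card_dual_cylinder[OF fG U cl KG bK uK] by simp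
    then have "card {x \<in> V. \<forall>i\<in>I. X x i = v i} * (2 ^ e) ^ t * card U = 2 ^ (card G - card K) * 2 ^ card K"
      by (simp add: cK mult_ac flip: power_mult)
    also have "\<dots> = card V * card U"
      using VU card_mono[OF fG KG] by (simp flip: power_add)
    finally have "card {x \<in> V. \<forall>i\<in>I. X x i = v i} * (2 ^ e) ^ t = card V"
      using cU0 by simp
    then show "real (card {x \<in> V. \<forall>i\<in>I. X x i = v i}) * real (2 ^ e) ^ t = real (card V)"
      by (simp only: of_nat_mult[symmetric] of_nat_power[symmetric])
  qed
  moreover have "x = y" if "x \<in> V" "y \<in> V" "\<forall>i\<in>{1..n}. X x i = X y i" for x y
  proof -
    have "\<forall>i\<in>{1..n}. x `` {i} = y `` {i}"
      using that \<beta>inj rowPow unfolding X_def by metis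
    moreover have "x \<subseteq> {1..n} \<times> UNIV" "y \<subseteq> {1..n} \<times> UNIV"
      using that unfolding V_def G_def by auto
    ultimately show ?thesis by blast
  qed
  then have "inj_on (\<lambda>x. restrict (X x) {1..n}) V"
    unfolding inj_on_restrict_rows_iff by blast
  ultimately show thesis using that V0 cV by blast
qed

section \<open>Passing to an arbitrary alphabet\<close>

lemma card_shift_bad:
  assumes "g \<le> (P::nat)" "P > 0"
  shows "card {a \<in> {..<P}. g \<le> (s + a) mod P} = P - g"
proof -
  have b: "bij_betw (\<lambda>a. (a + s) mod P) {..<P} {..<P}" by (rule bij_betw_add_mod[OF assms(2)])
  have "bij_betw (\<lambda>a. (a + s) mod P) {a \<in> {..<P}. g \<le> (s + a) mod P} {g..<P}"
    unfolding bij_betw_def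
  proof
    show "inj_on (\<lambda>a. (a + s) mod P) {a \<in> {..<P}. g \<le> (s + a) mod P}"
      using b unfolding bij_betw_def by (rule inj_on_subset[OF conjunct1]) auto
    have "{g..<P} \<subseteq> (\<lambda>a. (a + s) mod P) ` {..<P}" using b unfolding bij_betw_def by auto
    then show "(\<lambda>a. (a + s) mod P) ` {a \<in> {..<P}. g \<le> (s + a) mod P} = {g..<P}"
      using assms by (fastforce simp: add.commute)
  qed
  then show ?thesis using bij_betw_same_card by fastforce
qed

text \<open>A union bound over the rows and over the \<open>k\<close>-sets of coordinates: a translation is bad for a
row and a \<open>k\<close>-set with probability \<open>((P - g) / P) ^ k\<close>, and by hypothesis these probabilities add up
to less than one. Letters that are at least \<open>g\<close> are the exceptional ones that will be
replaced.\<close>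

lemma exists_shift_few_bad:
  assumes fR: "finite R" and g: "g \<le> P" "P > 0" and small: "card R * (n * (P - g)) ^ k < P ^ k"
  obtains s :: "nat \<Rightarrow> nat" where
    "\<And>r. r \<in> R \<Longrightarrow> card {i\<in>{1..n}. g \<le> (Y r i + s i) mod P} < k"
proof (rule ccontr)
  assume no: "\<not> thesis"
  have bad: "\<exists>r\<in>R. k \<le> card {i\<in>{1..n}. g \<le> (Y r i + s i) mod P}" for s
    using no that by (meson linorder_not_less)
  have kn: "k \<le> n"
  proof -
    obtain r where "k \<le> card {i\<in>{1..n}. g \<le> (Y r i + 0) mod P}" using bad[of "\<lambda>_. 0"] by blast
    also have "\<dots> \<le> card {1..n}" by (rule card_mono) auto
    finally show ?thesis by simp
  qed
  define W where "W = {1..n} \<rightarrow>\<^sub>E {..<P}"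
  define Ks where "Ks = {K. K \<subseteq> {1..n} \<and> card K = k}"
  define E where "E = (\<lambda>r K. PiE {1..n} (\<lambda>i. if i \<in> K then {a\<in>{..<P}. g \<le> (Y r i + a) mod P} else {..<P}))"
  have fKs: "finite Ks" unfolding Ks_def by simp
  have "W \<subseteq> (\<Union>r\<in>R. \<Union>K\<in>Ks. E r K)"
  proof
    fix s assume s: "s \<in> W"
    obtain r where r: "r \<in> R" "k \<le> card {i\<in>{1..n}. g \<le> (Y r i + s i) mod P}" using bad by blast
    obtain K where K: "K \<subseteq> {i\<in>{1..n}. g \<le> (Y r i + s i) mod P}" "card K = k"
      using obtain_subset_with_card_n[OF r(2)] by blast
    have "K \<in> Ks" unfolding Ks_def using K by auto
    moreover have "s \<in> E r K" using s K(1) unfolding E_def W_def by (auto simp: PiE_iff)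
    ultimately show "s \<in> (\<Union>r\<in>R. \<Union>K\<in>Ks. E r K)" using r(1) by blast
  qed
  moreover have fE: "finite (E r K)" for r K unfolding E_def by (rule finite_PiE) auto
  ultimately have "card W \<le> card (\<Union>r\<in>R. \<Union>K\<in>Ks. E r K)"
    using fR fKs by (intro card_mono) auto
  also have "\<dots> \<le> (\<Sum>r\<in>R. card (\<Union>K\<in>Ks. E r K))" by (rule card_UN_le[OF fR])
  also have "\<dots> \<le> (\<Sum>r\<in>R. \<Sum>K\<in>Ks. card (E r K))" by (intro sum_mono card_UN_le[OF fKs])
  also have "\<dots> = (\<Sum>r\<in>R. \<Sum>K\<in>Ks. (P - g) ^ k * P ^ (n - k))"
  proof (intro sum.cong refl)
    fix r K assume "K \<in> Ks"
    then have K: "K \<subseteq> {1..n}" "card K = k" "finite K" unfolding Ks_def using finite_subset by blast+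
    have "card (E r K) = (\<Prod>i\<in>{1..n}. if i \<in> K then P - g else P)"
      unfolding E_def by (subst card_PiE) (auto intro!: prod.cong simp: card_shift_bad[OF g, simplified])
    also have "\<dots> = (\<Prod>i\<in>K. P - g) * (\<Prod>i\<in>{1..n} - K. P)"
    proof -
      have "{1..n} \<inter> {i. i \<in> K} = K" "{1..n} \<inter> - {i. i \<in> K} = {1..n} - K"
        using K(1) by blast+
      then show ?thesis by (simp only: prod.If_cases[OF finite_atLeastAtMost])
    qed
    also have "\<dots> = (P - g) ^ k * P ^ (n - k)" using K by (simp add: card_Diff_subset)
    finally show "card (E r K) = (P - g) ^ k * P ^ (n - k)" .
  qed
  also have "\<dots> = card R * (card Ks * ((P - g) ^ k * P ^ (n - k)))" by simp
  also have "\<dots> \<le> card R * (n ^ k * ((P - g) ^ k * P ^ (n - k)))"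
    using card_subsets_le_power[OF kn] unfolding Ks_def by (intro mult_le_mono) auto
  also have "\<dots> = card R * (n * (P - g)) ^ k * P ^ (n - k)" by (simp add: power_mult_distrib mult_ac)
  also have "\<dots> < P ^ k * P ^ (n - k)" using small g by simp
  also have "\<dots> = P ^ n" using kn by (simp flip: power_add)
  also have "\<dots> = card W" unfolding W_def by (simp add: card_PiE)
  finally show False by simp
qed

lemma card_words_prescribed:
  assumes J: "finite J" and \<rho>: "inj_on \<rho> B" "\<rho> ` B \<subseteq> J" and v: "\<forall>i\<in>B. v i < q"
  shows "card {w \<in> J \<rightarrow>\<^sub>E {..<q}. \<forall>i\<in>B. w (\<rho> i) = v i} * q ^ card B = q ^ card J"
proof -
  define u where "u = (\<lambda>j. v (inv_into B \<rho> j))"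
  have u: "u (\<rho> i) = v i" if "i \<in> B" for i unfolding u_def using \<rho>(1) that by simp
  have "{w \<in> J \<rightarrow>\<^sub>E {..<q}. \<forall>i\<in>B. w (\<rho> i) = v i}
      = PiE J (\<lambda>j. if j \<in> \<rho> ` B then {u j} else {..<q})" (is "?L = ?R")
  proof
    show "?L \<subseteq> ?R" using u by (auto simp: PiE_iff extensional_def)
    show "?R \<subseteq> ?L"
    proof
      fix w assume w: "w \<in> ?R"
      have wB: "w (\<rho> i) = v i" if "i \<in> B" for i
      proof -
        have "\<rho> i \<in> J" "\<rho> i \<in> \<rho> ` B" using \<rho>(2) that by auto
        then have "w (\<rho> i) = u (\<rho> i)" using w by (auto simp: PiE_iff)
        then show ?thesis using u that by simp
      qed
      moreover have "w j < q" if "j \<in> J" for j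
      proof (cases "j \<in> \<rho> ` B")
        case True then show ?thesis using wB v by auto
      next
        case False then show ?thesis using w that by (auto simp: PiE_iff)
      qed
      ultimately show "w \<in> ?L" using w by (auto simp: PiE_iff)
    qed
  qed
  then have "card {w \<in> J \<rightarrow>\<^sub>E {..<q}. \<forall>i\<in>B. w (\<rho> i) = v i}
      = (\<Prod>j\<in>J. if j \<in> \<rho> ` B then 1 else q)"
    using J by (simp add: card_PiE) (auto intro!: prod.cong)
  also have "\<dots> = q ^ card (J - \<rho> ` B)"
    using J by (subst prod.If_cases) (auto simp: Diff_eq)
  also have "card (J - \<rho> ` B) = card J - card B"
    using \<rho> J by (simp add: card_Diff_subset finite_subset card_image)
  moreover have "card B \<le> card J" using \<rho> J by (metis card_image card_mono)
  ultimately show ?thesis by (simp flip: power_add)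
qed

lemma sum_mod_of_bool:
  assumes "v < (q::nat)"
  shows "(\<Sum>a<q * m. of_bool (a mod q = v)) = real m"
proof (induction m)
  case (Suc m)
  have "(\<Sum>a<q * Suc m. of_bool (a mod q = v) :: real)
      = (\<Sum>a<q * m. of_bool (a mod q = v)) + (\<Sum>a\<in>{q * m..<q * m + q}. of_bool (a mod q = v))"
    by (subst sum.union_disjoint[symmetric])
       (auto intro!: sum.cong simp del: sum_of_bool_eq)
  also have "(\<Sum>a\<in>{q * m..<q * m + q}. of_bool (a mod q = v) :: real) = (\<Sum>a<q. of_bool (a = v))"
  proof (rule sum.reindex_bij_witness[of _ "\<lambda>a. a + q * m" "\<lambda>a. a - q * m"])
    fix a assume a: "a \<in> {q * m..<q * m + q}"
    then obtain b where "a = q * m + b" "b < q" by (auto simp: le_iff_add)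
    then show "of_bool (a - q * m = v) = (of_bool (a mod q = v) :: real)" by simp
  qed auto
  also have "\<dots> = 1" using assms by (simp add: of_bool_def del: sum_of_bool_eq)
  finally show ?case using Suc by (simp del: sum_of_bool_eq)
qed simp

text \<open>Reduction modulo \<open>q\<close> is exactly uniform on the letters below the largest multiple \<open>g\<close> of \<open>q\<close>
that does not exceed \<open>P\<close>. The remaining letters of a row are replaced by fresh independent
letters, read from a word of length \<open>k\<close> that ranges over all words; a row has at most \<open>k\<close>
exceptional coordinates, so that distinct ones can read distinct positions of the fresh word.
Rows in which not all of the fresh word is read occur repeatedly, so the result is a family and not a set of words.\<close>

lemma uniform_rows_fill:
  fixes P q n t k :: nat
  assumes U: "uniform_rows P n t R Y" and q: "q > 0" and P: "P > 0"
    and few: "\<And>r. r \<in> R \<Longrightarrow> card {i\<in>{1..n}. q * (P div q) \<le> Y r i} \<le> k"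
  obtains X where "uniform_rows q n t (R \<times> ({..<k} \<rightarrow>\<^sub>E {..<q})) X"
proof -
  define g where "g = q * (P div q)"
  define S where "S = (\<lambda>r. {i\<in>{1..n}. g \<le> Y r i})"
  have fS: "finite (S r)" for r unfolding S_def by simp
  have "\<forall>r. \<exists>h. bij_betw h (S r) {0..<card (S r)}" using ex_bij_betw_finite_nat[OF fS] by blast
  then obtain \<rho> where \<rho>: "\<And>r. bij_betw (\<rho> r) (S r) {0..<card (S r)}" by metis
  define W where "W = {..<k} \<rightarrow>\<^sub>E {..<q}"
  have fW: "finite W" unfolding W_def by (rule finite_PiE) auto
  have cW: "card W = q ^ k" unfolding W_def by (simp add: card_PiE)
  define X where "X = (\<lambda>(r, w) i. if Y r i < g then Y r i mod q else w (\<rho> r i) :: nat)"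
  have fR: "finite R" using U by (simp add: uniform_rows_def)
  have \<rho>k: "\<rho> r i < k" if "r \<in> R" "i \<in> S r" for r i
  proof -
    have "\<rho> r i < card (S r)" using \<rho>[of r] that(2) unfolding bij_betw_def by fastforce
    then show ?thesis using few[OF that(1)] unfolding S_def g_def by simp
  qed
  have "uniform_rows q n t (R \<times> W) X"
  proof (rule uniform_rowsI)
    show "finite (R \<times> W)" using fR fW by simp
    fix z i assume z: "z \<in> R \<times> W" and i: "i \<in> {1..n}"
    obtain r w where rw: "z = (r, w)" "r \<in> R" "w \<in> W" using z by auto
    show "X z i < q"
    proof (cases "Y r i < g")
      case False
      then have "i \<in> S r" using i unfolding S_def by simp
      then have "\<rho> r i \<in> {..<k}" using \<rho>k rw(2) by simp
      then show ?thesis using rw False unfolding X_def W_def by auto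
    qed (use q rw in \<open>simp add: X_def\<close>)
  next
    fix I v assume I: "I \<subseteq> {1..n}" "card I = t" "finite I" "\<forall>i\<in>I. v i < q"
    \<comment> \<open>the conditional probability, over the fresh letters, that a letter \<open>a\<close> of \<open>Y r\<close> produces \<open>v i\<close>\<close>
    define h where "h = (\<lambda>i a. if a < g then of_bool (a mod q = v i) else 1 / real q)"
    have fill: "(\<Sum>w\<in>W. \<Prod>i\<in>I. of_bool (X (r, w) i = v i)) = real q ^ k * (\<Prod>i\<in>I. h i (Y r i))"
      if r: "r \<in> R" for r
    proof -
      define B where "B = I \<inter> S r"
      have fB: "finite B" using I(3) unfolding B_def by simp
      have split: "(\<Prod>i\<in>I. f i) = (\<Prod>i\<in>I - B. f i) * (\<Prod>i\<in>B. f i)" for f :: "nat \<Rightarrow> real"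
        using prod.subset_diff[of B I f] I(3) unfolding B_def by simp
      have good: "Y r i < g" if "i \<in> I - B" for i using that I(1) unfolding B_def S_def by auto
      have bad: "\<not> Y r i < g" if "i \<in> B" for i using that unfolding B_def S_def by auto
      have inj: "inj_on (\<rho> r) B" using \<rho>[of r] unfolding bij_betw_def B_def by (blast intro: inj_on_subset)
      have img: "\<rho> r ` B \<subseteq> {..<k}" using \<rho>k[OF r] unfolding B_def by auto
      have "card {w \<in> W. \<forall>i\<in>B. w (\<rho> r i) = v i} * q ^ card B = q ^ card {..<k}"
        unfolding W_def by (rule card_words_prescribed) (use inj img I(4) in \<open>auto simp: B_def\<close>)
      then have "real (card {w \<in> W. \<forall>i\<in>B. w (\<rho> r i) = v i} * q ^ card B) = real (q ^ k)"
        by simp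
      then have cnt: "real (card {w \<in> W. \<forall>i\<in>B. w (\<rho> r i) = v i}) = real q ^ k * (\<Prod>i\<in>B. 1 / real q)"
        using q by (simp add: field_simps)
      have "(\<Sum>w\<in>W. \<Prod>i\<in>I. of_bool (X (r, w) i = v i) :: real)
          = (\<Sum>w\<in>W. (\<Prod>i\<in>I - B. of_bool (Y r i mod q = v i)) * (\<Prod>i\<in>B. of_bool (w (\<rho> r i) = v i)))"
        unfolding split using good bad
        by (intro sum.cong refl arg_cong2[where f = "(*)"] prod.cong) (auto simp: X_def)
      also have "\<dots> = (\<Prod>i\<in>I - B. of_bool (Y r i mod q = v i)) * (real q ^ k * (\<Prod>i\<in>B. 1 / real q))"
        by (simp only: sum_distrib_left[symmetric] sum_prod_of_bool[OF fW fB] cnt)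
      also have "\<dots> = real q ^ k * ((\<Prod>i\<in>I - B. h i (Y r i)) * (\<Prod>i\<in>B. h i (Y r i)))"
      proof -
        have "(\<Prod>i\<in>I - B. of_bool (Y r i mod q = v i)) = (\<Prod>i\<in>I - B. h i (Y r i))"
          using good by (intro prod.cong) (auto simp: h_def)
        moreover have "(\<Prod>i\<in>B. 1 / real q) = (\<Prod>i\<in>B. h i (Y r i))"
          using bad by (intro prod.cong) (auto simp: h_def)
        ultimately show ?thesis by simp
      qed
      finally show ?thesis unfolding split[of "\<lambda>i. h i (Y r i)"] .
    qed
    have gP: "g \<le> P" and Pg: "P - g = P mod q" unfolding g_def by (simp_all add: minus_mult_div_eq_mod)
    have hsum: "(\<Sum>a<P. h i a) = real P / real q" if "i \<in> I" for i
    proof -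
      have "{..<P} = {..<g} \<union> {g..<P}" using gP by auto
      moreover have "sum (h i) ({..<g} \<union> {g..<P}) = sum (h i) {..<g} + sum (h i) {g..<P}"
        by (rule sum.union_disjoint) auto
      ultimately have "(\<Sum>a<P. h i a) = (\<Sum>a<g. h i a) + (\<Sum>a\<in>{g..<P}. h i a)"
        by (rule ssubst)
      also have "(\<Sum>a<g. h i a) = (\<Sum>a<q * (P div q). of_bool (a mod q = v i))"
        unfolding g_def[symmetric] by (intro sum.cong) (auto simp: h_def)
      also have "\<dots> = real (P div q)" using I(4) that by (intro sum_mod_of_bool) auto
      also have "(\<Sum>a\<in>{g..<P}. h i a) = (\<Sum>a\<in>{g..<P}. 1 / real q)"
        by (intro sum.cong) (auto simp: h_def)
      also have "\<dots> = real (P mod q) / real q" using Pg by simp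
      also have "real (P div q) + real (P mod q) / real q = real P / real q"
      proof -
        have "real P = real (q * (P div q) + P mod q)" by simp
        then have "real P = real q * real (P div q) + real (P mod q)" by (simp only: of_nat_add of_nat_mult)
        then show ?thesis using q by (simp add: field_simps)
      qed
      finally show ?thesis .
    qed
    have "(\<Sum>r\<in>R. \<Prod>i\<in>I. h i (Y r i)) * real P ^ t = real (card R) * (\<Prod>i\<in>I. real P / real q)"
      using uniform_rows_test[OF U I(1,2), of h] hsum by simp
    then have base: "(\<Sum>r\<in>R. \<Prod>i\<in>I. h i (Y r i)) * real q ^ t = real (card R)"
      using P q I(2) by (simp add: field_simps power_divide)
    have "(\<Sum>z\<in>R \<times> W. \<Prod>i\<in>I. of_bool (X z i = v i))
        = (\<Sum>r\<in>R. \<Sum>w\<in>W. \<Prod>i\<in>I. of_bool (X (r, w) i = v i) :: real)"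
      by (simp add: sum.cartesian_product del: sum_of_bool_eq)
    also have "\<dots> = real q ^ k * (\<Sum>r\<in>R. \<Prod>i\<in>I. h i (Y r i))"
      using fill by (simp add: sum_distrib_left)
    finally show "(\<Sum>z\<in>R \<times> W. \<Prod>i\<in>I. of_bool (X z i = v i)) * real q ^ t = real (card (R \<times> W))"
      using base cW by (simp add: card_cartesian_product mult_ac)
  qed
  then show thesis using that unfolding W_def by blast
qed

section \<open>Removing repetitions\<close>

text \<open>The translations are chosen one index at a time: each of the at most \<open>card R * M\<close> points
already used excludes at most \<open>M\<close> of the translations for the next index.\<close>

lemma greedy_disjoint:
  assumes R: "finite R" and \<Theta>: "finite \<Theta>"
    and fin: "\<And>r \<tau>. finite (F r \<tau>)" and cF: "\<And>r \<tau>. card (F r \<tau>) \<le> M"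
    and hit: "\<And>r x. r \<in> R \<Longrightarrow> card {\<tau>\<in>\<Theta>. x \<in> F r \<tau>} \<le> M"
    and small: "card R * M * M < card \<Theta>"
  shows "\<exists>\<tau>. (\<forall>r\<in>R. \<tau> r \<in> \<Theta>) \<and> (\<forall>r\<in>R. \<forall>s\<in>R. r \<noteq> s \<longrightarrow> F r (\<tau> r) \<inter> F s (\<tau> s) = {})"
  using R hit small
proof (induction R rule: finite_induct)
  case (insert r R)
  have "card R * M * M \<le> card (insert r R) * M * M"
    using insert.hyps by (intro mult_le_mono) auto
  then have "card R * M * M < card \<Theta>" using insert.prems(2) by (rule le_less_trans)
  then have "\<exists>\<tau>. (\<forall>r\<in>R. \<tau> r \<in> \<Theta>) \<and> (\<forall>r\<in>R. \<forall>s\<in>R. r \<noteq> s \<longrightarrow> F r (\<tau> r) \<inter> F s (\<tau> s) = {})"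
    by (intro insert.IH insert.prems(1)) auto
  then obtain \<tau> where \<tau>: "\<forall>r\<in>R. \<tau> r \<in> \<Theta>" "\<forall>r\<in>R. \<forall>s\<in>R. r \<noteq> s \<longrightarrow> F r (\<tau> r) \<inter> F s (\<tau> s) = {}"
    by (elim exE conjE)
  define Used where "Used = (\<Union>s\<in>R. F s (\<tau> s))"
  have fU: "finite Used" unfolding Used_def using insert.hyps fin by blast
  have "card Used \<le> (\<Sum>s\<in>R. card (F s (\<tau> s)))"
    unfolding Used_def by (rule card_UN_le[OF insert.hyps(1)])
  also have "\<dots> \<le> (\<Sum>s\<in>R. M)" by (intro sum_mono cF)
  finally have cU: "card Used \<le> card R * M" by simp
  have "card (\<Union>x\<in>Used. {\<theta>\<in>\<Theta>. x \<in> F r \<theta>}) \<le> (\<Sum>x\<in>Used. card {\<theta>\<in>\<Theta>. x \<in> F r \<theta>})"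
    by (rule card_UN_le[OF fU])
  also have "\<dots> \<le> (\<Sum>x\<in>Used. M)" using insert.prems(1) by (intro sum_mono) auto
  also have "\<dots> \<le> card R * M * M" using cU by simp
  also have "\<dots> < card \<Theta>" by fact
  finally have less: "card (\<Union>x\<in>Used. {\<theta>\<in>\<Theta>. x \<in> F r \<theta>}) < card \<Theta>" .
  have "finite (\<Union>x\<in>Used. {\<theta>\<in>\<Theta>. x \<in> F r \<theta>})" using fU \<Theta> by simp
  then have "\<not> \<Theta> \<subseteq> (\<Union>x\<in>Used. {\<theta>\<in>\<Theta>. x \<in> F r \<theta>})"
    using card_mono less by (metis linorder_not_less)
  then obtain \<theta> where \<theta>: "\<theta> \<in> \<Theta>" "F r \<theta> \<inter> Used = {}" by blast
  have "\<forall>s\<in>R. F r \<theta> \<inter> F s (\<tau> s) = {}" using \<theta>(2) unfolding Used_def by blast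
  then have "\<forall>a\<in>insert r R. \<forall>b\<in>insert r R. a \<noteq> b \<longrightarrow>
      F a ((\<tau>(r := \<theta>)) a) \<inter> F b ((\<tau>(r := \<theta>)) b) = {}"
    using \<tau>(2) insert.hyps(2) by (metis Int_commute fun_upd_apply insert_iff)
  moreover have "\<forall>a\<in>insert r R. (\<tau>(r := \<theta>)) a \<in> \<Theta>" using \<tau>(1) \<theta>(1) by simp
  ultimately show ?case by blast
qed simp

text \<open>Every row \<open>X r\<close> is replaced by the set of its sums with a translated copy of a second array
\<open>Z\<close> without repetitions. For a fixed translation the letters of the copy on \<open>t\<close>
coordinates have the same (uniform) distribution whatever \<open>r\<close> is, and are therefore
independent of the letters of \<open>X r\<close>; so the translations can be chosen freely in dependence
of \<open>r\<close> without destroying the strength, and they are chosen to make all sums distinct. The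
alphabet of \<open>Z\<close> may be smaller than \<open>q\<close>, because uniformity of \<open>X\<close> alone makes the sums
uniform.\<close>

lemma exists_injective_translates:
  assumes U: "uniform_rows q n t R X" and Z: "uniform_rows p n t J Z" and p: "0 < p" "p \<le> q"
    and injZ: "inj_on (\<lambda>j. restrict (Z j) {1..n}) J"
    and small: "card R * card J * card J < p ^ n"
  obtains x where "uniform_rows q n t (R \<times> J) x"
    "inj_on (\<lambda>z. restrict (x z) {1..n}) (R \<times> J)"
proof -
  have q: "q > 0" using p by simp
  have fR: "finite R" and fJ: "finite J" using U Z by (simp_all add: uniform_rows_def)
  define \<Theta> where "\<Theta> = {1..n} \<rightarrow>\<^sub>E {..<p}"
  have f\<Theta>: "finite \<Theta>" unfolding \<Theta>_def by (rule finite_PiE) auto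
  have c\<Theta>: "card \<Theta> = p ^ n" unfolding \<Theta>_def by (simp add: card_PiE)
  define row where "row = (\<lambda>r \<tau> j. restrict (\<lambda>i. ((Z j i + \<tau> i) mod p + X r i) mod q) {1..n})"
  define F where "F = (\<lambda>r \<tau>. row r \<tau> ` J)"
  have injmod: "a = b" if "(a + s) mod m = (b + s) mod m" "a < m" "b < m" for a b s m :: nat
    using mod_add_right_cancel_nat[OF that(1)] that by simp
  have rowD: "(Z j i + \<tau> i) mod p = (Z j' i + \<tau>' i) mod p"
    if "row r \<tau> j = row r \<tau>' j'" "i \<in> {1..n}" for r \<tau> \<tau>' j j' i
  proof -
    have "((Z j i + \<tau> i) mod p + X r i) mod q = ((Z j' i + \<tau>' i) mod p + X r i) mod q"
      using fun_cong[OF that(1), of i] that(2) unfolding row_def by simp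
    moreover have "(Z j i + \<tau> i) mod p < q" "(Z j' i + \<tau>' i) mod p < q"
      using p by (meson mod_less_divisor order_less_le_trans)+
    ultimately show ?thesis by (rule injmod)
  qed
  have hit: "card {\<tau>\<in>\<Theta>. y \<in> F r \<tau>} \<le> card J" for r y
  proof -
    have one: "card {\<tau>\<in>\<Theta>. y = row r \<tau> j} \<le> 1" for j
    proof -
      have "\<tau> = \<tau>'" if t: "\<tau> \<in> \<Theta>" "\<tau>' \<in> \<Theta>" and e: "row r \<tau> j = row r \<tau>' j" for \<tau> \<tau>'
      proof (rule PiE_ext[OF t[unfolded \<Theta>_def]])
        fix i assume i: "i \<in> {1..n}"
        have "(\<tau> i + Z j i) mod p = (\<tau>' i + Z j i) mod p"
          using rowD[OF e i] by (simp add: add.commute)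
        moreover have "\<tau> i < p" "\<tau>' i < p" using t i unfolding \<Theta>_def by auto
        ultimately show "\<tau> i = \<tau>' i" by (rule injmod)
      qed
      then show ?thesis by (auto simp: card_le_Suc0_iff_eq f\<Theta>)
    qed
    have "{\<tau>\<in>\<Theta>. y \<in> F r \<tau>} = (\<Union>j\<in>J. {\<tau>\<in>\<Theta>. y = row r \<tau> j})" unfolding F_def by blast
    also have "card \<dots> \<le> (\<Sum>j\<in>J. card {\<tau>\<in>\<Theta>. y = row r \<tau> j})" by (rule card_UN_le[OF fJ])
    also have "\<dots> \<le> (\<Sum>j\<in>J. 1)" by (intro sum_mono one)
    finally show ?thesis by simp
  qed
  have "\<exists>\<tau>. (\<forall>r\<in>R. \<tau> r \<in> \<Theta>) \<and> (\<forall>r\<in>R. \<forall>s\<in>R. r \<noteq> s \<longrightarrow> F r (\<tau> r) \<inter> F s (\<tau> s) = {})"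
    by (rule greedy_disjoint[OF fR f\<Theta>, where M = "card J"])
       (use fJ hit small c\<Theta> in \<open>auto simp: F_def card_image_le\<close>)
  then obtain \<tau> where \<tau>: "\<And>r s. r \<in> R \<Longrightarrow> s \<in> R \<Longrightarrow> r \<noteq> s \<Longrightarrow> F r (\<tau> r) \<inter> F s (\<tau> s) = {}" by blast
  define x where "x = (\<lambda>(r, j) i. ((Z j i + \<tau> r i) mod p + X r i) mod q)"
  have "uniform_rows q n t (R \<times> J) x"
  proof (rule uniform_rowsI)
    show "finite (R \<times> J)" using fR fJ by simp
    show "x z i < q" for z i using q by (cases z) (simp add: x_def)
    fix I v assume I: "I \<subseteq> {1..n}" "card I = t" "finite I" "\<forall>i\<in>I. v i < q"
    \<comment> \<open>up to the factor \<open>p\<close>, the probability that the letter \<open>b\<close> of \<open>X r\<close> is moved to \<open>v i\<close>\<close>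
    define h where "h = (\<lambda>i b. \<Sum>a<p. of_bool ((a + b) mod q = v i) :: real)"
    have inner: "(\<Sum>j\<in>J. \<Prod>i\<in>I. of_bool (x (r, j) i = v i)) * real p ^ t
        = real (card J) * (\<Prod>i\<in>I. h i (X r i))" for r
      using uniform_rows_test[OF uniform_rows_shift[OF Z p(1), of "\<tau> r"] I(1,2),
          of "\<lambda>i a. of_bool ((a + X r i) mod q = v i)"]
      unfolding x_def h_def by (simp del: sum_of_bool_eq)
    have "(\<Sum>b<q. h i b) = real p" if "i \<in> I" for i
    proof -
      have "(\<Sum>b<q. h i b) = (\<Sum>a<p. \<Sum>b<q. of_bool ((b + a) mod q = v i))"
        unfolding h_def by (subst sum.swap) (simp add: add.commute del: sum_of_bool_eq)
      then show ?thesis using I(4) that by (simp add: sum_add_mod_of_bool del: sum_of_bool_eq)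
    qed
    then have outer: "(\<Sum>r\<in>R. \<Prod>i\<in>I. h i (X r i)) * real q ^ t = real (card R) * real p ^ t"
      using uniform_rows_test[OF U I(1,2), of h] I(2) by simp
    have "(\<Sum>z\<in>R \<times> J. \<Prod>i\<in>I. of_bool (x z i = v i))
        = (\<Sum>r\<in>R. \<Sum>j\<in>J. \<Prod>i\<in>I. of_bool (x (r, j) i = v i) :: real)"
      by (simp add: sum.cartesian_product del: sum_of_bool_eq)
    then have "(\<Sum>z\<in>R \<times> J. \<Prod>i\<in>I. of_bool (x z i = v i)) * real p ^ t * real q ^ t
        = (\<Sum>r\<in>R. (\<Sum>j\<in>J. \<Prod>i\<in>I. of_bool (x (r, j) i = v i)) * real p ^ t) * real q ^ t"
      by (simp only: sum_distrib_right)
    also have "\<dots> = real (card J) * ((\<Sum>r\<in>R. \<Prod>i\<in>I. h i (X r i)) * real q ^ t)"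
      unfolding inner by (simp add: sum_distrib_left sum_distrib_right mult_ac)
    also have "\<dots> = real (card (R \<times> J)) * real p ^ t"
      unfolding outer by (simp add: card_cartesian_product mult_ac)
    finally show "(\<Sum>z\<in>R \<times> J. \<Prod>i\<in>I. of_bool (x z i = v i)) * real q ^ t = real (card (R \<times> J))"
      using p(1) by (simp add: mult.assoc mult.left_commute del: sum_of_bool_eq)
  qed
  moreover have "a = b" if ab: "a \<in> R \<times> J" "b \<in> R \<times> J" "\<forall>i\<in>{1..n}. x a i = x b i" for a b
  proof -
    obtain r j r' j' where e: "a = (r, j)" "b = (r', j')" "r \<in> R" "j \<in> J" "r' \<in> R" "j' \<in> J"
      using ab by auto
    have eq: "row r (\<tau> r) j = row r' (\<tau> r') j'"
      using ab(3) unfolding e x_def row_def by (auto simp: restrict_def fun_eq_iff)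
    then have "F r (\<tau> r) \<inter> F r' (\<tau> r') \<noteq> {}" unfolding F_def using e by auto
    then have rr: "r = r'" using \<tau> e by blast
    have "Z j i = Z j' i" if i: "i \<in> {1..n}" for i
    proof (rule injmod)
      show "(Z j i + \<tau> r i) mod p = (Z j' i + \<tau> r i) mod p"
        using rowD[OF eq[folded rr] i] .
      show "Z j i < p" "Z j' i < p" using Z e i by (auto simp: uniform_rows_def)
    qed
    then show ?thesis using injZ[unfolded inj_on_restrict_rows_iff] e rr by blast
  qed
  then have "inj_on (\<lambda>z. restrict (x z) {1..n}) (R \<times> J)"
    unfolding inj_on_restrict_rows_iff by blast
  ultimately show thesis using that by blast
qed

section \<open>Orthogonal arrays of polynomial size\<close>

lemma uniform_rows_all_words: "uniform_rows q n t ({1..n} \<rightarrow>\<^sub>E {..<q}) (\<lambda>w. w)"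
  unfolding uniform_rows_def
proof (intro conjI ballI allI impI)
  show "finite ({1..n} \<rightarrow>\<^sub>E {..<q})" by (rule finite_PiE) auto
  fix I v assume I: "I \<subseteq> {1..n}" "card I = t" "\<forall>i\<in>I. v i < q"
  have "card {w \<in> {1..n} \<rightarrow>\<^sub>E {..<q}. \<forall>i\<in>I. w (id i) = v i} * q ^ card I = q ^ card {1..n}"
    by (rule card_words_prescribed) (use I in auto)
  then have "card {w \<in> {1..n} \<rightarrow>\<^sub>E {..<q}. \<forall>i\<in>I. w i = v i} * q ^ t = card ({1..n} \<rightarrow>\<^sub>E {..<q})"
    using I(2) by (simp add: card_PiE)
  then show "real (card {w \<in> {1..n} \<rightarrow>\<^sub>E {..<q}. \<forall>i\<in>I. w i = v i}) * real q ^ t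
      = real (card ({1..n} \<rightarrow>\<^sub>E {..<q}))"
    by (simp only: of_nat_mult[symmetric] of_nat_power[symmetric])
qed auto

lemma orthogonal_array_of_rows:
  assumes U: "uniform_rows q n t R x" and q: "q > 0"
    and inj: "inj_on (\<lambda>r. restrict (x r) {1..n}) R"
  shows "\<exists>T. orthogonal_array q n t T \<and> card T = card R"
proof -
  define f where "f = (\<lambda>r. restrict (\<lambda>i. x r i + 1) {1..n})"
  have f: "f r i = x r i + 1" if "i \<in> {1..n}" for r i using that unfolding f_def by simp
  have injf: "inj_on f R"
  proof (rule inj_onI)
    fix a b assume ab: "a \<in> R" "b \<in> R" "f a = f b"
    have "x a i = x b i" if "i \<in> {1..n}" for i
      using fun_cong[OF ab(3), of i] f[OF that] by simp
    then show "a = b" using inj[unfolded inj_on_restrict_rows_iff] ab by blast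
  qed
  have "orthogonal_array q n t (f ` R)" unfolding orthogonal_array_def
  proof (intro conjI allI impI)
    show "f ` R \<subseteq> words q n"
    proof
      fix y assume "y \<in> f ` R"
      then obtain r where r: "r \<in> R" "y = f r" by blast
      have "x r i + 1 \<in> {1..q}" if "i \<in> {1..n}" for i
        using U r that unfolding uniform_rows_def by fastforce
      then show "y \<in> words q n" unfolding words_def r f_def by (auto simp: PiE_iff)
    qed
    fix i v :: "nat \<Rightarrow> nat"
    assume a: "inj_on i {1..t} \<and> i ` {1..t} \<subseteq> {1..n} \<and> v ` {1..t} \<subseteq> {1..q}"
    define I where "I = i ` {1..t}"
    define u where "u = (\<lambda>m. v (inv_into {1..t} i m) - 1)"
    have I: "I \<subseteq> {1..n}" "card I = t" using a unfolding I_def by (auto simp: card_image)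
    have uij: "u (i j) = v j - 1" if "j \<in> {1..t}" for j
      unfolding u_def using a that by simp
    have vj: "v j \<ge> 1" "v j \<le> q" if "j \<in> {1..t}" for j using a that by (auto simp: image_subset_iff)
    have "u m < q" if "m \<in> I" for m
      using that uij vj q unfolding I_def by fastforce
    then have cnt: "real (card {r \<in> R. \<forall>m\<in>I. x r m = u m}) * real q ^ t = real (card R)"
      using U I unfolding uniform_rows_def by blast
    have "(\<forall>j\<in>{1..t}. f r (i j) = v j) \<longleftrightarrow> (\<forall>m\<in>I. x r m = u m)" for r
    proof -
      have "f r (i j) = v j \<longleftrightarrow> x r (i j) = u (i j)" if j: "j \<in> {1..t}" for j
      proof -
        have "i j \<in> {1..n}" using a j by blast
        then show ?thesis using f[of "i j" r] uij[OF j] vj[OF j] by auto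
      qed
      then show ?thesis unfolding I_def by auto
    qed
    then have "{y \<in> f ` R. \<forall>j\<in>{1..t}. y (i j) = v j} = f ` {r \<in> R. \<forall>m\<in>I. x r m = u m}"
      by blast
    moreover have "inj_on f {r \<in> R. \<forall>m\<in>I. x r m = u m}" using injf by (rule inj_on_subset) auto
    ultimately have "card {y \<in> f ` R. \<forall>j\<in>{1..t}. y (i j) = v j} = card {r \<in> R. \<forall>m\<in>I. x r m = u m}"
      by (simp add: card_image)
    then show "real (card {y \<in> f ` R. \<forall>j\<in>{1..t}. y (i j) = v j}) = real (card (f ` R)) / real q ^ t"
      using cnt q injf by (simp add: card_image field_simps)
  qed
  moreover have "card (f ` R) = card R" using injf by (rule card_image)
  ultimately show ?thesis by blast
qed

text \<open>The alphabet size \<open>P\<close> is a power of two of order \<open>(n * q) ^ 3\<close>. Fewer than \<open>q\<close> of the \<open>P\<close>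
letters are exceptional, so the union bound over the at most \<open>(n * P) ^ t\<close> rows and the sets of
\<open>2 * t\<close> coordinates requires \<open>n * (n * q)\<^sup>2 < P\<close>.\<close>

lemma exists_small_uniform_rows:
  fixes q n t :: nat
  assumes q: "2 \<le> q" and n: "1 \<le> n" and t: "1 \<le> t" "t \<le> n"
  obtains V :: "(nat \<times> nat) set set" and X where
    "uniform_rows q n t (V \<times> ({..<2 * t} \<rightarrow>\<^sub>E {..<q})) X" "V \<noteq> {}"
    "card (V \<times> ({..<2 * t} \<rightarrow>\<^sub>E {..<q})) \<le> ((n * q) ^ 6) ^ t"
proof -
  have "1 \<le> (n * q) ^ 3" using q n by simp
  then obtain e where e: "2 ^ e \<le> (n * q) ^ 3" "(n * q) ^ 3 < 2 ^ (e + 1)"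
    using ex_power_ivl1[of 2 "(n * q) ^ 3"] by auto
  define P where "P = (2::nat) ^ (e + 1)"
  have P: "(n * q) ^ 3 < P" "P \<le> 2 * (n * q) ^ 3" using e unfolding P_def by auto
  have P0: "P > 0" unfolding P_def by simp
  obtain V :: "(nat \<times> nat) set set" and Y where V: "uniform_rows P n t V Y" "V \<noteq> {}" "card V \<le> (n * P) ^ t"
    using exists_binary_array[OF t(2), of "e + 1"] unfolding P_def by metis
  have fV: "finite V" using V(1) by (simp add: uniform_rows_def)
  define g where "g = q * (P div q)"
  have gP: "g \<le> P" and Pg: "P - g < q" unfolding g_def using q by (simp_all add: minus_mult_div_eq_mod)
  have "card V * (n * (P - g)) ^ (2 * t) \<le> (n * P) ^ t * (n * q) ^ (2 * t)"
    using V(3) Pg by (intro mult_le_mono power_mono) auto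
  also have "\<dots> = (n * (n * q)\<^sup>2 * P) ^ t"
    unfolding power_mult[of "n * q" 2 t] by (simp only: power_mult_distrib mult_ac)
  also have "\<dots> < (P * P) ^ t"
  proof (rule power_strict_mono)
    have "n * (n * q)\<^sup>2 \<le> (n * q) * (n * q)\<^sup>2" using q by (intro mult_le_mono) auto
    also have "\<dots> = (n * q) ^ 3" by (simp add: power3_eq_cube power2_eq_square)
    finally show "n * (n * q)\<^sup>2 * P < P * P" using P(1) P0 by simp
  qed (use t in auto)
  also have "\<dots> = P ^ (2 * t)" by (simp add: power_mult power2_eq_square)
  finally obtain s where s: "\<And>r. r \<in> V \<Longrightarrow> card {i\<in>{1..n}. g \<le> (Y r i + s i) mod P} < 2 * t"
    using exists_shift_few_bad[OF fV gP P0, of n "2 * t" Y] by metis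
  obtain X where X: "uniform_rows q n t (V \<times> ({..<2 * t} \<rightarrow>\<^sub>E {..<q})) X"
  proof (rule uniform_rows_fill[OF uniform_rows_shift[OF V(1) P0, of s] _ P0, of q "2 * t"])
    show "q > 0" using q by simp
    show "card {i\<in>{1..n}. q * (P div q) \<le> (Y r i + s i) mod P} \<le> 2 * t" if "r \<in> V" for r
      using s[OF that] unfolding g_def by simp
  qed
  have "card (V \<times> ({..<2 * t} \<rightarrow>\<^sub>E {..<q})) = card V * q ^ (2 * t)"
    by (simp add: card_cartesian_product card_PiE)
  also have "\<dots> \<le> (n * P) ^ t * q ^ (2 * t)" using V(3) by simp
  also have "\<dots> = (n * P * q\<^sup>2) ^ t"
    unfolding power_mult[of q 2 t] by (simp only: power_mult_distrib)
  also have "\<dots> \<le> ((n * q) ^ 6) ^ t"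
  proof (rule power_mono)
    have "n * P * q\<^sup>2 \<le> n * (2 * (n * q) ^ 3) * q\<^sup>2" using P(2) by (intro mult_le_mono) auto
    also have "\<dots> \<le> n * (q * (n * q) ^ 3) * q\<^sup>2" using q by (intro mult_le_mono) auto
    also have "\<dots> = n * (n * q) ^ 3 * q ^ 3" by (simp add: power3_eq_cube power2_eq_square)
    also have "\<dots> \<le> n ^ 3 * (n * q) ^ 3 * q ^ 3" using n by (intro mult_le_mono) (auto simp: self_le_power)
    also have "\<dots> = (n * q) ^ (3 + 3)" by (simp only: power_add power_mult_distrib mult_ac)
    finally show "n * P * q\<^sup>2 \<le> (n * q) ^ 6" by simp
  qed simp
  finally show thesis using that X V(2) by blast
qed

theorem theorem1p1:
  shows "\<exists>c::real. c > 0 \<and>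
    (\<forall>q n t :: nat. 2 \<le> q \<longrightarrow> 1 \<le> n \<longrightarrow> 1 \<le> t \<longrightarrow> t \<le> n \<longrightarrow>
      (\<exists>T. T \<noteq> {} \<and> orthogonal_array q n t T \<and>
        real (card T) \<le> real (q * n) powr (c * real t)))"
proof (intro exI[of _ 16] conjI allI impI)
  fix q n t :: nat
  assume q: "2 \<le> q" and n: "1 \<le> n" and t: "1 \<le> t" "t \<le> n"
  have nq: "1 \<le> n * q" using q n by simp
  obtain e where "2 ^ e \<le> q" "q < 2 ^ (e + 1)" using ex_power_ivl1[of 2 q] q by auto
  \<comment> \<open>the largest power of two up to \<open>q\<close>; since \<open>q < 2 * p\<close> and \<open>p \<ge> 2\<close>, it is at least the square root of \<open>q\<close>\<close>
  define p where "p = (2::nat) ^ e"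
  have p: "0 < p" "p \<le> q" "q < 2 * p" using \<open>2 ^ e \<le> q\<close> \<open>q < 2 ^ (e + 1)\<close> by (auto simp: p_def)
  have p2: "p \<ge> 2" using p(3) q unfolding p_def by (cases e) auto
  have "\<exists>T. orthogonal_array q n t T \<and> 0 < card T \<and> card T \<le> ((n * q) ^ 16) ^ t"
  proof (cases "((n * q) ^ 8) ^ t < p ^ n")
    case True
    obtain V :: "(nat \<times> nat) set set" and X where
      X: "uniform_rows q n t (V \<times> ({..<2 * t} \<rightarrow>\<^sub>E {..<q})) X" "V \<noteq> {}"
      and cR: "card (V \<times> ({..<2 * t} \<rightarrow>\<^sub>E {..<q})) \<le> ((n * q) ^ 6) ^ t"
      using exists_small_uniform_rows[OF q n t] by metis
    define R where "R = V \<times> ({..<2 * t} \<rightarrow>\<^sub>E {..<q})"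
    have "(\<lambda>i\<in>{..<2 * t}. 0) \<in> {..<2 * t} \<rightarrow>\<^sub>E {..<q}" using q by auto
    then have "R \<noteq> {}" unfolding R_def using X(2) by blast
    moreover have "finite R" using X(1) unfolding R_def by (simp add: uniform_rows_def)
    ultimately have R0: "0 < card R" by (simp add: card_gt_0_iff)
    obtain J :: "(nat \<times> nat) set set" and Z where Z: "uniform_rows p n t J Z" "J \<noteq> {}" "card J \<le> (n * p) ^ t"
      "inj_on (\<lambda>j. restrict (Z j) {1..n}) J"
      using exists_binary_array[OF t(2), of e] unfolding p_def by metis
    have J0: "0 < card J" using Z(1,2) by (simp add: uniform_rows_def card_gt_0_iff)
    have "(n * p) ^ t \<le> (n * q) ^ t" using p by (intro power_mono) auto
    then have cJ: "card J \<le> (n * q) ^ t" using Z(3) by simp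
    have "card R * card J * card J \<le> ((n * q) ^ 6) ^ t * (n * q) ^ t * (n * q) ^ t"
      using cR cJ unfolding R_def by (intro mult_le_mono) auto
    also have "\<dots> = ((n * q) ^ 8) ^ t"
      by (simp flip: power_mult power_add)
    also have "\<dots> < p ^ n" by fact
    finally have small: "card R * card J * card J < p ^ n" .
    obtain x where x: "uniform_rows q n t (R \<times> J) x"
      "inj_on (\<lambda>z. restrict (x z) {1..n}) (R \<times> J)"
      using exists_injective_translates[OF X(1)[folded R_def] Z(1) p(1,2) Z(4) small] by blast
    obtain T where T: "orthogonal_array q n t T" "card T = card R * card J"
      using orthogonal_array_of_rows[OF x(1) _ x(2)] p(1,2) by (auto simp: card_cartesian_product)
    have "card T \<le> ((n * q) ^ 6) ^ t * (n * q) ^ t"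
      unfolding T(2) using cR cJ unfolding R_def by (rule mult_le_mono)
    also have "\<dots> = (n * q) ^ (7 * t)" by (simp flip: power_mult power_add)
    also have "\<dots> \<le> (n * q) ^ (16 * t)" using nq by (intro power_increasing) auto
    finally have "card T \<le> ((n * q) ^ 16) ^ t" by (simp add: power_mult)
    then show ?thesis using T R0 J0 by auto
  next
    case False
    \<comment> \<open>too few words for the greedy choice, but then the set of all words is small enough\<close>
    obtain T where T: "orthogonal_array q n t T" "card T = q ^ n"
    proof -
      have "\<exists>T. orthogonal_array q n t T \<and> card T = card ({1..n} \<rightarrow>\<^sub>E {..<q})"
        by (rule orthogonal_array_of_rows[OF uniform_rows_all_words])
          (use q in \<open>auto intro!: inj_onI simp: PiE_restrict\<close>)
      then show thesis using that by (auto simp: card_PiE)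
    qed
    have "2 * p \<le> p * p" using p2 by (intro mult_le_mono) auto
    then have "q \<le> p\<^sup>2" unfolding power2_eq_square using p(3) by linarith
    then have "q ^ n \<le> (p\<^sup>2) ^ n" by (rule power_mono) simp
    also have "\<dots> = (p ^ n)\<^sup>2" by (simp add: mult.commute flip: power_mult)
    also have "\<dots> \<le> (((n * q) ^ 8) ^ t)\<^sup>2" using False by (intro power_mono) auto
    also have "\<dots> = ((n * q) ^ 16) ^ t" by (simp add: mult.commute flip: power_mult)
    finally show ?thesis using T q by auto
  qed
  then obtain T where T: "orthogonal_array q n t T" "0 < card T" "card T \<le> ((n * q) ^ 16) ^ t" by blast
  have "real (card T) \<le> real (((n * q) ^ 16) ^ t)" using T(3) by (simp only: of_nat_le_iff)
  also have "\<dots> = real (q * n) ^ (16 * t)"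
    by (simp only: of_nat_power power_mult mult.commute[of n q])
  also have "\<dots> = real (q * n) powr (16 * real t)"
    using nq by (subst powr_realpow[symmetric]) auto
  finally show "\<exists>T. T \<noteq> {} \<and> orthogonal_array q n t T \<and> real (card T) \<le> real (q * n) powr (16 * real t)"
    using T(1,2) by (metis card.empty less_irrefl)
qed simp

end
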